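(* Let $d\ge3$, $s\in(0,d-2]$ and $C>0$. There is a constant $B>0$, not depending on $N$ or on the configuration, such that the following holds: if $\omega_N=\{x_1,\dots,x_N\}\subset\mathbb{S}^d$ satisfies $$P_s(\omega_N)\ge N I_{s}-C s N^{\frac{s}{s+2}},$$ and $x\in\mathbb{S}^d$ is such that $\sum_{j=1}^N K_s(x,x_j)=P_s(\omega_N)$, then for all $j\in\{1,\dots,N\}$ $$\|x-x_j\|\ge B N^{-\frac1{s+2}}.$$
   Context: $\mathbb{S}^d=\{x\in\mathbb{R}^{d+1}:\|x\|=1\}$ with $\|\cdot\|$ the Euclidean norm; $\sigma$ is the normalized uniform (surface) probability measure on $\mathbb{S}^d$. For $s>0$, $K_s(x,y)=\frac1s\|x-y\|^{-s}$ (equal to $+\infty$ on the diagonal), $I_s=\int_{\mathbb{S}^d}\int_{\mathbb{S}^d}K_s(x,y)\,d\sigma(x)\,d\sigma(y)$, and $P_s(\omega_N)=\min_{x\in\mathbb{S}^d}\sum_{j=1}^NK_s(x,x_j)$. *)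

theory Defs
  imports "HOL-Probability.Probability"
begin

text \<open>
  The sphere in \<open>real ^ 'n\<close> is \<open>sphere 0 1\<close>, of dimension \<open>CARD('n) - 1\<close>.

  The normalized surface measure is obtained from the uniform distribution on the unit ball by
  radial projection \<open>x \<mapsto> x / \<parallel>x\<parallel>\<close>: the measure of a Borel set of directions is the
  volume fraction of the cone over it. It is kept as a Borel measure on the ambient space;
  \<open>emeasure_sphere_unif_sphere\<close> shows that it lives on the sphere, so integrals over the sphere are
  plain integrals with respect to it. The value of the projection at the origin (namely \<open>0\<close>)
  is irrelevant, since the origin is a null set.
\<close>

definition sphere_unif :: "(real ^ 'n) measure" where
  "sphere_unif = distr (uniform_measure lborel (ball 0 1)) borel (\<lambda>x. x /\<^sub>R norm x)"

text \<open>
  On the diagonal \<open>0 powr (- s)\<close> would be \<open>0\<close>, so the value \<open>\<infinity>\<close> there is stated explicitly.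
\<close>

definition riesz_kernel :: "real \<Rightarrow> real ^ 'n \<Rightarrow> real ^ 'n \<Rightarrow> ennreal" where
  "riesz_kernel s x y = (if x = y then \<infinity> else ennreal (1 / s * norm (x - y) powr (- s)))"

text \<open>
  The index type of the ambient space cannot be inferred from the value of the energy and is
  therefore passed as an explicit type argument.
\<close>

definition riesz_energy :: "'n::finite itself \<Rightarrow> real \<Rightarrow> ennreal" where
  "riesz_energy _ s =
     (\<integral>\<^sup>+ x. (\<integral>\<^sup>+ y. riesz_kernel s x y \<partial>sphere_unif) \<partial>(sphere_unif :: (real ^ 'n) measure))"

definition riesz_potential :: "real \<Rightarrow> nat \<Rightarrow> (nat \<Rightarrow> real ^ 'n) \<Rightarrow> real ^ 'n \<Rightarrow> ennreal" where
  "riesz_potential s N p x = (\<Sum>j=1..N. riesz_kernel s x (p j))"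

text \<open>
  The configuration consists of the points \<open>p 1, \<dots>, p N\<close>. The infimum is a minimum, because
  the potential is lower semicontinuous on the compact sphere.
\<close>

definition polarization :: "real \<Rightarrow> nat \<Rightarrow> (nat \<Rightarrow> real ^ 'n) \<Rightarrow> ennreal" where
  "polarization s N p = (INF x \<in> sphere 0 1. riesz_potential s N p x)"

lemma sets_sphere_unif [simp, measurable_cong]: "sets sphere_unif = sets borel"
  by (simp add: sphere_unif_def)

lemma space_sphere_unif [simp]: "space sphere_unif = UNIV"
  by (simp add: sphere_unif_def)

lemma emeasure_unit_ball_pos: "emeasure lborel (ball (0 :: real ^ 'n) 1) \<noteq> 0"
proof -
  have "unit_ball_vol (real CARD('n)) > 0" by (rule unit_ball_vol_pos) simp
  then show ?thesis by (simp add: emeasure_ball less_imp_neq[symmetric])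
qed

lemma prob_space_sphere_unif: "prob_space (sphere_unif :: (real ^ 'n) measure)"
  unfolding sphere_unif_def
  by (intro prob_space.prob_space_distr prob_space_uniform_measure emeasure_unit_ball_pos)
     (use emeasure_lborel_ball_finite[of "0 :: real ^ 'n" 1] in \<open>auto simp: less_top\<close>)

lemma emeasure_sphere_unif_sphere: "emeasure sphere_unif (sphere (0 :: real ^ 'n) 1) = 1"
proof -
  interpret prob_space "sphere_unif :: (real ^ 'n) measure"
    by (rule prob_space_sphere_unif)
  have ae: "AE x in lborel. x \<noteq> (0 :: real ^ 'n)"
    by (rule AE_lborel_singleton)
  have "AE x in uniform_measure lborel (ball (0 :: real ^ 'n) 1). x /\<^sub>R norm x \<in> sphere 0 1"
    by (rule AE_uniform_measureI) (use ae in \<open>auto simp: field_simps\<close>)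
  then have "AE x in sphere_unif. x \<in> sphere (0 :: real ^ 'n) 1"
    unfolding sphere_unif_def by (subst AE_distr_iff) auto
  then show ?thesis
    by (intro emeasure_eq_1_AE) auto
qed

text \<open>
  The normalized surface measure is the unique probability measure on the sphere that is invariant
  under orthogonal maps; the invariance follows from that of Lebesgue measure.
\<close>

lemma distr_lborel_orthogonal:
  fixes f :: "real ^ 'n \<Rightarrow> real ^ 'n"
  assumes f: "orthogonal_transformation f"
  shows "distr lborel borel f = lborel"
proof (rule measure_eqI)
  let ?L = "lborel :: (real ^ 'n) measure"
  have lin: "linear f" using f by (rule orthogonal_transformation_linear)
  have [measurable]: "f \<in> borel \<rightarrow>\<^sub>M borel"
    using lin by (intro borel_measurable_continuous_onI linear_continuous_on)
      (simp add: linear_linear)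
  have plus: "(\<integral>\<^sup>+ x. h (a + x) \<partial>?L) = (\<integral>\<^sup>+ x. h x \<partial>?L)"
    if [measurable]: "h \<in> borel_measurable borel" for h :: "real ^ 'n \<Rightarrow> ennreal" and a
    by (subst (2) lborel_distr_plus[of a, symmetric]) (simp add: nn_integral_distr)
  have minus: "(\<integral>\<^sup>+ x. h (a - x) \<partial>?L) = (\<integral>\<^sup>+ x. h x \<partial>?L)"
    if [measurable]: "h \<in> borel_measurable borel" for h :: "real ^ 'n \<Rightarrow> ennreal" and a
    by (subst (2) lborel_affine[of "-1" a]) (simp_all add: nn_integral_distr nn_integral_density)
  fix A assume "A \<in> sets (distr lborel borel f)"
  then have A [measurable]: "A \<in> sets borel" by simp
  let ?B = "ball (0 :: real ^ 'n) 1"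
  define a b :: "real ^ 'n \<Rightarrow> ennreal" where ab: "a = indicator A" "b = indicator ?B"
  have [measurable]: "a \<in> borel_measurable borel" "b \<in> borel_measurable borel"
    unfolding ab by (auto intro!: borel_measurable_indicator)
  have ints: "(\<integral>\<^sup>+ x. a x \<partial>?L) = emeasure ?L A" "(\<integral>\<^sup>+ x. b x \<partial>?L) = emeasure ?L ?B"
    by (simp_all add: ab)
  define I where "I = (\<integral>\<^sup>+ x. a (f x) \<partial>?L)"
  have fB: "b (f x) = b x" for x
    using f by (simp add: ab indicator_def orthogonal_transformation_norm)
  have fadd: "f (x + y) = f x + f y" "f (x - y) = f x - f y" for x y
    using lin by (simp_all add: linear_add linear_diff)
  have "I * emeasure ?L ?B = (\<integral>\<^sup>+ x. a (f x) * (\<integral>\<^sup>+ y. b y \<partial>?L) \<partial>?L)"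
    unfolding I_def by (simp add: nn_integral_multc ints)
  also have "\<dots> = (\<integral>\<^sup>+ x. a (f x) * (\<integral>\<^sup>+ y. b (f x + y) \<partial>?L) \<partial>?L)"
    by (simp add: plus)
  also have "\<dots> = (\<integral>\<^sup>+ x. (\<integral>\<^sup>+ y. a (f x) * b (f x + y) \<partial>?L) \<partial>?L)"
    by (intro nn_integral_cong nn_integral_cmult[symmetric]) measurable
  also have "\<dots> = (\<integral>\<^sup>+ y. (\<integral>\<^sup>+ x. a (f x) * b (f x + y) \<partial>?L) \<partial>?L)"
    by (rule lborel_pair.Fubini') measurable
  also have "\<dots> = (\<integral>\<^sup>+ y. (\<integral>\<^sup>+ x. a (f x - y) * b (f x) \<partial>?L) \<partial>?L)"
  proof (rule nn_integral_cong)
    fix y :: "real ^ 'n"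
    obtain z where z: "f z = y" using orthogonal_transformation_surj[OF f] by (metis surjD)
    show "(\<integral>\<^sup>+ x. a (f x) * b (f x + y) \<partial>?L) = (\<integral>\<^sup>+ x. a (f x - y) * b (f x) \<partial>?L)"
      using plus[of "\<lambda>x. a (f x - y) * b (f x)" z] by (simp add: fadd z add.commute)
  qed
  also have "\<dots> = (\<integral>\<^sup>+ x. (\<integral>\<^sup>+ y. a (f x - y) * b (f x) \<partial>?L) \<partial>?L)"
    by (rule lborel_pair.Fubini') measurable
  also have "\<dots> = (\<integral>\<^sup>+ x. (\<integral>\<^sup>+ y. a (f x - y) \<partial>?L) * b x \<partial>?L)"
    by (simp add: nn_integral_multc fB)
  also have "\<dots> = emeasure ?L A * emeasure ?L ?B"
    by (simp add: minus nn_integral_cmult ints)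
  finally have "I * emeasure ?L ?B = emeasure ?L A * emeasure ?L ?B" .
  then have "I = emeasure ?L A"
    using emeasure_unit_ball_pos[where 'n='n] emeasure_lborel_ball_finite[of "0 :: real ^ 'n" 1]
    by (metis ennreal_mult_cancel_left infinity_ennreal_def less_irrefl mult.commute)
  moreover have "I = emeasure (distr lborel borel f) A"
    unfolding I_def ab by (subst nn_integral_distr[symmetric, of f _ borel]) simp_all
  ultimately show "emeasure (distr lborel borel f) A = emeasure lborel A" by simp
qed simp

lemma sphere_unif_orthogonal_invariant:
  fixes f :: "real ^ 'n \<Rightarrow> real ^ 'n"
  assumes f: "orthogonal_transformation f"
  shows "distr sphere_unif borel f = sphere_unif"
proof (rule measure_eqI)
  have [measurable]: "f \<in> borel \<rightarrow>\<^sub>M borel"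
    using f by (intro borel_measurable_continuous_onI linear_continuous_on)
      (simp add: linear_linear orthogonal_transformation_linear)
  let ?r = "\<lambda>x :: real ^ 'n. x /\<^sub>R norm x"
  fix A assume "A \<in> sets (distr sphere_unif borel f)"
  then have A [measurable]: "A \<in> sets borel" by simp
  define B where "B = ball 0 1 \<inter> ?r -` A"
  define B' where "B' = ball 0 1 \<inter> ?r -` (f -` A)"
  have "?r \<in> borel \<rightarrow>\<^sub>M borel" by measurable
  from measurable_sets[OF this A] have B: "B \<in> sets borel"
    unfolding B_def by auto
  have fA: "f -` A \<in> sets borel"
    using measurable_sets[OF \<open>f \<in> borel \<rightarrow>\<^sub>M borel\<close> A] by simp
  from measurable_sets[OF \<open>?r \<in> borel \<rightarrow>\<^sub>M borel\<close> this] have B': "B' \<in> sets borel"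
    unfolding B'_def by auto
  have "emeasure lborel B = emeasure (distr lborel borel f) B"
    by (simp add: distr_lborel_orthogonal[OF f])
  also have "\<dots> = emeasure lborel (f -` B)"
    using B by (simp add: emeasure_distr)
  also have "f -` B = B'"
    using f by (auto simp: B_def B'_def orthogonal_transformation_norm orthogonal_transformation_scaleR)
  finally have "emeasure lborel B = emeasure lborel B'" .
  then show "emeasure (distr sphere_unif borel f) A = emeasure sphere_unif A"
    using A fA measurable_sets[OF \<open>?r \<in> borel \<rightarrow>\<^sub>M borel\<close> A]
      measurable_sets[OF \<open>?r \<in> borel \<rightarrow>\<^sub>M borel\<close> fA]
    by (simp add: sphere_unif_def emeasure_distr measurable_sets_borel B_def B'_def)
qed simp

end

theory Submission
  imports Defs
begin

text \<open>
  In stereographic coordinates \<open>u\<close> centred at \<open>x\<close> (so that \<open>x\<close> is \<open>u = 0\<close>) the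
  potential \<open>U\<close> becomes \<open>(1 + |u|\<^sup>2) powr (s/2)\<close> times a superposition of kernels
  \<open>|u - v| powr (-s)\<close> on \<open>d\<close>-dimensional Euclidean space, which are superharmonic because
  \<open>s \<le> d - 2\<close>. Averaging over a centred Gaussian of variance \<open>t\<close> therefore does not increase
  any kernel, and brings it below a multiple of \<open>t powr (-s/2)\<close> when its pole is near \<open>x\<close>.
  Since the potential is at least \<open>U(x)\<close> everywhere, this gives
  \<open>(1 - s d t / 2) U(x) \<le> U(x) - K\<^sub>s(x, x\<^sub>j) + c t powr (-s/2)\<close>, while \<open>t = 1/(s d)\<close> and
  the averages alone give \<open>U(x) \<le> M N\<close>. With \<open>t = N powr (-2/(s+2))\<close> the two error terms
  balance, so \<open>K\<^sub>s(x, x\<^sub>j)\<close> is at most a constant times \<open>N powr (s/(s+2))\<close>.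
\<close>

subsection \<open>Gaussian averages of inverse powers\<close>

text \<open>Rescaling Euler's integral by \<open>q\<close> turns it into a representation of
  \<open>q powr - \<alpha>\<close> as a superposition of exponentials in \<open>q\<close>. Gaussian
  averages of such exponentials are explicit, unlike those of the power itself.\<close>

lemma nn_integral_Gamma_rate:
  fixes \<alpha> q :: real
  assumes "\<alpha> > 0" "q > 0"
  shows "(\<integral>\<^sup>+t. ennreal (indicator {0..} t * t powr (\<alpha> - 1) * exp (- (q * t))) \<partial>lborel)
           = ennreal (Gamma \<alpha> * q powr - \<alpha>)"
proof -
  let ?h = "\<lambda>t :: real. indicator {0..} t * t powr (\<alpha> - 1) * exp (- (q * t))"
  have "ennreal (Gamma \<alpha>) =
      ennreal \<bar>q\<bar> * (\<integral>\<^sup>+t. ennreal (indicator {0..} (0 + q * t) * (0 + q * t) powr (\<alpha> - 1)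
                               / exp (0 + q * t)) \<partial>lborel)"
    using assms
    by (subst Gamma_conv_nn_integral_real, simp, subst nn_integral_real_affine[where c = q and t = 0])
       auto
  also have "\<dots> = ennreal \<bar>q\<bar> * (\<integral>\<^sup>+t. ennreal (q powr (\<alpha> - 1)) * ennreal (?h t) \<partial>lborel)"
  proof (intro arg_cong2[where f = "(*)"] nn_integral_cong refl)
    fix t :: real
    have "q * t < 0" if "t < 0" using assms that by (rule_tac mult_pos_neg)
    then show "ennreal (indicator {0..} (0 + q * t) * (0 + q * t) powr (\<alpha> - 1) / exp (0 + q * t))
        = ennreal (q powr (\<alpha> - 1)) * ennreal (?h t)"
      using assms
      by (subst ennreal_mult'[symmetric], simp, cases "t < 0")
         (simp_all add: powr_mult exp_minus divide_inverse mult_ac)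
  qed
  also have "\<dots> = ennreal (q powr \<alpha>) * (\<integral>\<^sup>+t. ennreal (?h t) \<partial>lborel)"
    using assms
    by (subst nn_integral_cmult)
       (auto simp: mult.assoc[symmetric] powr_diff simp flip: ennreal_mult')
  finally have "ennreal (q powr - \<alpha>) * ennreal (Gamma \<alpha>)
      = ennreal (q powr - \<alpha>) * ennreal (q powr \<alpha>) * (\<integral>\<^sup>+t. ennreal (?h t) \<partial>lborel)"
    by (simp add: mult.assoc)
  also have "ennreal (q powr - \<alpha>) * ennreal (q powr \<alpha>) = 1"
    using assms by (simp add: powr_minus flip: ennreal_mult')
  finally show ?thesis
    using assms by (simp add: mult.commute flip: ennreal_mult')
qed

text \<open>The integrals with positive rate lie below this one and are unbounded as the rate tends
  to 0. The value is needed at the pole, so that the superposition of exponentials also represents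
  the kernel where it is infinite.\<close>

lemma nn_integral_Gamma_rate_0:
  fixes \<alpha> :: real
  assumes "\<alpha> > 0"
  shows "(\<integral>\<^sup>+t. ennreal (indicator {0..} t * t powr (\<alpha> - 1)) \<partial>lborel) = \<infinity>"
    (is "?I = _")
proof (rule ccontr)
  assume "?I \<noteq> \<infinity>"
  then obtain r where r: "r \<ge> 0" "?I = ennreal r" by (cases ?I) auto
  \<comment> \<open>The rate at which the Gamma integral equals \<open>r + 1\<close>, more than the
    supposed value \<open>r\<close>.\<close>
  define q where "q = ((r + 1) / Gamma \<alpha>) powr (- 1 / \<alpha>)"
  have G: "Gamma \<alpha> > 0" using assms by (rule Gamma_real_pos)
  have q: "q > 0" using G r by (simp add: q_def)
  have "Gamma \<alpha> * q powr - \<alpha> = r + 1"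
    using G less_imp_neq[OF G] r assms by (simp add: q_def powr_powr)
  then have "ennreal (r + 1) = (\<integral>\<^sup>+t. ennreal (indicator {0..} t * t powr (\<alpha> - 1) * exp (- (q * t))) \<partial>lborel)"
    using nn_integral_Gamma_rate[OF assms q] by simp
  also have "\<dots> \<le> ?I"
    using q by (intro nn_integral_mono ennreal_leI) (auto simp: indicator_def intro!: mult_left_le)
  finally show False using r by simp
qed

text \<open>
  Substitution of \<open>t / (1 + 2 * a * t)\<close> for \<open>t\<close>; applied with \<open>\<alpha> = s / 2\<close> and \<open>\<beta> = d / 2\<close>, the
  condition on the exponents is \<open>s \<le> d - 2\<close>.
\<close>

lemma nn_integral_subst_rate_le:
  fixes \<alpha> a \<beta> \<rho> :: real
  assumes "\<alpha> > 0" "a \<ge> 0" "\<alpha> + 1 \<le> \<beta>"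
    and f: "f = (\<lambda>t. indicator {0..} t * t powr (\<alpha> - 1) * exp (- (\<rho> * t)))"
  shows "(\<integral>\<^sup>+t. ennreal (indicator {0..} t * t powr (\<alpha> - 1) * (1 + 2 * a * t) powr - \<beta>
              * exp (- (\<rho> * (t / (1 + 2 * a * t))))) \<partial>lborel)
           \<le> (\<integral>\<^sup>+t. ennreal (f t) * indicator {t. 2 * a * t \<le> 1} t \<partial>lborel)" (is "(\<integral>\<^sup>+t. ?h t \<partial>_) \<le> ?R")
proof -
  \<comment> \<open>\<open>g\<close> is the new variable and \<open>g'\<close> its
    derivative.\<close>
  define g g' where "g t = t / (1 + 2 * a * t)" and "g' t = 1 / (1 + 2 * a * t)\<^sup>2" for t :: real
  have pos: "1 + 2 * a * t > 0" if "t \<ge> 0" for t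
    using that assms(2) by (smt (verit) mult_nonneg_nonneg)
  \<comment> \<open>The substitution is carried out on compact intervals; monotone convergence in
    \<open>n\<close> then gives the half-line.\<close>
  have bound: "(\<integral>\<^sup>+t. ?h t * indicator {0..real n} t \<partial>lborel) \<le> ?R" for n :: nat
  proof -
    have "(\<integral>\<^sup>+t. ?h t * indicator {0..real n} t \<partial>lborel)
        \<le> (\<integral>\<^sup>+t. f (g t) * g' t * indicator {0..real n} t \<partial>lborel)"
    proof (intro nn_integral_mono)
      fix t :: real
      show "?h t * indicator {0..real n} t \<le> ennreal (f (g t) * g' t * indicator {0..real n} t)"
      proof (cases "t \<in> {0..real n} \<and> t > 0")
        case True
        let ?D = "1 + 2 * a * t"
        have D: "?D > 0" "?D \<ge> 1" using True assms(2) pos by auto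
        \<comment> \<open>The condition on the exponents enters here: of the power
          \<open>\<alpha> + 1\<close>, the part \<open>\<alpha> - 1\<close> turns \<open>t\<close>
          into \<open>g t\<close> and the remaining 2 is the Jacobian.\<close>
        have "t powr (\<alpha> - 1) * ?D powr - \<beta> \<le> t powr (\<alpha> - 1) * ?D powr - (\<alpha> + 1)"
          using D assms(3) by (intro mult_left_mono powr_mono) auto
        also have "?D powr - (\<alpha> + 1) = ?D powr (- (\<alpha> - 1) + - 2)"
          by (simp add: algebra_simps)
        also have "\<dots> = ?D powr - (\<alpha> - 1) * g' t"
          unfolding powr_add using D by (simp add: g'_def powr_minus_divide)
        also have "t powr (\<alpha> - 1) * (?D powr - (\<alpha> - 1) * g' t) = (t / ?D) powr (\<alpha> - 1) * g' t"
          unfolding powr_minus_divide using D True by (simp add: powr_divide)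
        finally show ?thesis
          using True D unfolding f g_def
          by (auto simp: indicator_def mult_ac intro!: ennreal_leI mult_left_mono)
      qed (auto simp: indicator_def)
    qed
    also have "\<dots> = (\<integral>\<^sup>+t. f t * indicator {g 0..g (real n)} t \<partial>lborel)"
    proof (rule nn_integral_substitution[symmetric])
      show "set_borel_measurable borel {g 0..g (real n)} f"
        unfolding f set_borel_measurable_def by measurable
      show "(g has_real_derivative g' x) (at x)" if "x \<in> {0..real n}" for x
        unfolding g_def g'_def using pos[of x] that
        by (auto intro!: derivative_eq_intros simp: power2_eq_square)
      show "continuous_on {0..real n} g'"
        unfolding g'_def using pos by (intro continuous_intros) force
    qed (auto simp: g'_def)
    also have "\<dots> \<le> ?R"
    proof (intro nn_integral_mono)
      fix t :: real
      \<comment> \<open>All values of \<open>g\<close> satisfy this bound, and that is where the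
        cutoff on the right-hand side comes from.\<close>
      have "2 * a * g (real n) \<le> 1"
        using pos[of "real n"] by (simp add: g_def field_simps)
      then have "2 * a * t \<le> 1" if "t \<le> g (real n)"
        using that assms(2) by (smt (verit) mult_left_mono)
      then show "ennreal (f t * indicator {g 0..g (real n)} t)
          \<le> ennreal (f t) * indicator {t. 2 * a * t \<le> 1} t"
        by (auto simp: indicator_def)
    qed
    finally show ?thesis .
  qed
  have "(\<integral>\<^sup>+t. ?h t \<partial>lborel) = (\<integral>\<^sup>+t. (SUP n. ?h t * indicator {0..real n} t) \<partial>lborel)"
  proof (intro nn_integral_cong antisym SUP_least)
    fix t :: real
    obtain n where n: "t \<le> real n" using real_arch_simple by blast
    have "?h t \<le> ?h t * indicator {0..real n} t" using n by (auto simp: indicator_def)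
    then show "?h t \<le> (SUP n. ?h t * indicator {0..real n} t)" by (rule SUP_upper2[rotated]) simp
  qed (auto simp: indicator_def)
  also have "\<dots> = (SUP n. \<integral>\<^sup>+t. ?h t * indicator {0..real n} t \<partial>lborel)"
    by (intro nn_integral_monotone_convergence_SUP)
       (auto simp: incseq_def le_fun_def indicator_def)
  also have "\<dots> \<le> ?R" using bound by (rule SUP_least)
  finally show ?thesis .
qed

section \<open>Gaussian integrals of exponentials of quadratic polynomials\<close>

lemma nn_integral_normal_quadratic:
  fixes \<sigma> A B :: real
  assumes "\<sigma> > 0" "A \<ge> 0"
  shows "(\<integral>\<^sup>+z. ennreal (exp (B * z - A * z\<^sup>2)) \<partial>density lborel (normal_density 0 \<sigma>))
     = ennreal (exp (B\<^sup>2 * \<sigma>\<^sup>2 / (2 * (1 + 2 * A * \<sigma>\<^sup>2))) * (1 + 2 * A * \<sigma>\<^sup>2) powr - (1 / 2))"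
proof -
  define D where "D = 1 + 2 * A * \<sigma>\<^sup>2"
  define \<tau> where "\<tau> = \<sigma> / sqrt D"
  have D: "D > 0" using assms by (simp add: D_def add_pos_nonneg)
  have \<tau>: "\<tau> > 0" "\<tau>\<^sup>2 = \<sigma>\<^sup>2 / D" using D assms by (auto simp: \<tau>_def power_divide)
  define c where "c = exp (B\<^sup>2 * \<sigma>\<^sup>2 / (2 * D)) * D powr - (1 / 2)"
  \<comment> \<open>Completing the square: up to the constant \<open>c\<close>, the integrand is
    again a normal density, with variance \<open>\<tau>\<^sup>2\<close> and mean
    \<open>B * \<tau>\<^sup>2\<close>.\<close>
  have *: "normal_density 0 \<sigma> z * exp (B * z - A * z\<^sup>2) = c * normal_density (B * \<tau>\<^sup>2) \<tau> z" for z
  proof -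
    have AD: "A = (D - 1) / (2 * \<sigma>\<^sup>2)" using assms by (simp add: D_def)
    have 1: "- z\<^sup>2 / (2 * \<sigma>\<^sup>2) + (B * z - A * z\<^sup>2)
        = B\<^sup>2 * \<sigma>\<^sup>2 / (2 * D) + - (z - B * \<tau>\<^sup>2)\<^sup>2 / (2 * \<tau>\<^sup>2)"
      using assms D unfolding \<tau> AD by (simp add: field_simps power2_eq_square)
    have 2: "1 / sqrt (2 * pi * \<sigma>\<^sup>2) = D powr - (1 / 2) * (1 / sqrt (2 * pi * \<tau>\<^sup>2))"
      using assms D unfolding \<tau>
      by (simp add: powr_minus powr_half_sqrt real_sqrt_mult real_sqrt_divide field_simps)
    show ?thesis
      unfolding normal_density_def c_def 2 diff_0_right
      unfolding mult.assoc arg_cong[OF 1, of exp, unfolded exp_add]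
      by (simp only: ac_simps)
  qed
  have "(\<integral>\<^sup>+z. ennreal (exp (B * z - A * z\<^sup>2)) \<partial>density lborel (normal_density 0 \<sigma>))
      = (\<integral>\<^sup>+z. ennreal (normal_density 0 \<sigma> z * exp (B * z - A * z\<^sup>2)) \<partial>lborel)"
    by (subst nn_integral_density) (auto simp: ennreal_mult')
  also have "\<dots> = (\<integral>\<^sup>+z. ennreal c * ennreal (normal_density (B * \<tau>\<^sup>2) \<tau> z) \<partial>lborel)"
    by (simp add: * c_def ennreal_mult')
  also have "\<dots> = ennreal c"
    using \<tau> by (subst nn_integral_cmult) (auto simp: nn_integral_eq_integral)
  finally show ?thesis by (simp add: c_def D_def)
qed

text \<open>The index set is an arbitrary set \<open>S\<close>, so that it can later be an
  orthonormal frame of a tangent space, with \<open>z b\<close> the coordinate along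
  \<open>b\<close>.\<close>

definition gauss :: "real \<Rightarrow> 'a set \<Rightarrow> ('a \<Rightarrow> real) measure" where
  "gauss \<sigma> S = PiM S (\<lambda>_. density lborel (normal_density 0 \<sigma>))"

lemma sets_gauss [measurable_cong]: "sets (gauss \<sigma> S) = sets (PiM S (\<lambda>_. borel))"
  unfolding gauss_def by (intro sets_PiM_cong) auto

lemma prob_space_gauss: "\<sigma> > 0 \<Longrightarrow> prob_space (gauss \<sigma> S)"
  unfolding gauss_def by (intro prob_space_PiM prob_space_normal_density)

lemma nn_integral_gauss_quadratic:
  fixes \<sigma> A :: real
  assumes "\<sigma> > 0" "A \<ge> 0" "finite S"
  shows "(\<integral>\<^sup>+z. ennreal (exp (\<Sum>b\<in>S. B b * z b - A * (z b)\<^sup>2)) \<partial>gauss \<sigma> S)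
     = ennreal (exp ((\<Sum>b\<in>S. (B b)\<^sup>2) * \<sigma>\<^sup>2 / (2 * (1 + 2 * A * \<sigma>\<^sup>2)))
                * (1 + 2 * A * \<sigma>\<^sup>2) powr - (real (card S) / 2))"
proof -
  let ?M = "density lborel (normal_density 0 \<sigma>)"
  interpret prob_space ?M using assms(1) by (rule prob_space_normal_density)
  interpret product_sigma_finite "\<lambda>_ :: 'a. ?M" ..
  have D: "1 + 2 * A * \<sigma>\<^sup>2 > 0" using assms by (simp add: add_pos_nonneg)
  have "(\<integral>\<^sup>+z. ennreal (exp (\<Sum>b\<in>S. B b * z b - A * (z b)\<^sup>2)) \<partial>gauss \<sigma> S)
      = (\<integral>\<^sup>+z. (\<Prod>b\<in>S. ennreal (exp (B b * z b - A * (z b)\<^sup>2))) \<partial>PiM S (\<lambda>_. ?M))"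
    using assms(3) by (simp add: gauss_def exp_sum prod_ennreal)
  also have "\<dots> = (\<Prod>b\<in>S. \<integral>\<^sup>+z. ennreal (exp (B b * z - A * z\<^sup>2)) \<partial>?M)"
    using assms(3) by (rule product_nn_integral_prod) auto
  also have "\<dots> = (\<Prod>b\<in>S. ennreal (exp ((B b)\<^sup>2 * \<sigma>\<^sup>2 / (2 * (1 + 2 * A * \<sigma>\<^sup>2)))
                              * (1 + 2 * A * \<sigma>\<^sup>2) powr - (1 / 2)))"
    using assms by (simp add: nn_integral_normal_quadratic)
  also have "\<dots> = ennreal (\<Prod>b\<in>S. exp ((B b)\<^sup>2 * \<sigma>\<^sup>2 / (2 * (1 + 2 * A * \<sigma>\<^sup>2)))
                              * (1 + 2 * A * \<sigma>\<^sup>2) powr - (1 / 2))"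
    by (rule prod_ennreal) auto
  also have "(\<Prod>b\<in>S. exp ((B b)\<^sup>2 * \<sigma>\<^sup>2 / (2 * (1 + 2 * A * \<sigma>\<^sup>2))) * (1 + 2 * A * \<sigma>\<^sup>2) powr - (1 / 2))
     = exp ((\<Sum>b\<in>S. (B b)\<^sup>2) * \<sigma>\<^sup>2 / (2 * (1 + 2 * A * \<sigma>\<^sup>2)))
                * (1 + 2 * A * \<sigma>\<^sup>2) powr - (real (card S) / 2)"
    using assms(3) D
    by (simp add: prod.distrib exp_sum[symmetric] sum_divide_distrib sum_distrib_right
                  powr_power)
  finally show ?thesis .
qed

lemma nn_integral_gauss_square:
  fixes \<sigma> :: real
  assumes "\<sigma> > 0" "finite S"
  shows "(\<integral>\<^sup>+z. ennreal (\<Sum>b\<in>S. (z b)\<^sup>2) \<partial>gauss \<sigma> S) = ennreal (real (card S) * \<sigma>\<^sup>2)"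
proof -
  let ?M = "density lborel (normal_density 0 \<sigma>)"
  interpret prob_space ?M using assms(1) by (rule prob_space_normal_density)
  interpret product_prob_space "\<lambda>_ :: 'a. ?M" S ..
  have hb: "has_bochner_integral lborel (\<lambda>z. normal_density 0 \<sigma> z * z\<^sup>2) (\<sigma>\<^sup>2)"
    using normal_moment_even[OF assms(1), of 0 1] by simp
  have 1: "(\<integral>\<^sup>+z. ennreal (z\<^sup>2) \<partial>?M) = ennreal (\<sigma>\<^sup>2)"
  proof -
    have "(\<integral>\<^sup>+z. ennreal (z\<^sup>2) \<partial>?M) = (\<integral>\<^sup>+z. ennreal (normal_density 0 \<sigma> z * z\<^sup>2) \<partial>lborel)"
      by (subst nn_integral_density) (auto simp: ennreal_mult')
    also have "\<dots> = ennreal (\<sigma>\<^sup>2)"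
      using hb by (subst nn_integral_eq_integral) (auto simp: has_bochner_integral_iff)
    finally show ?thesis .
  qed
  have component: "(\<integral>\<^sup>+z. ennreal ((z b)\<^sup>2) \<partial>gauss \<sigma> S) = ennreal (\<sigma>\<^sup>2)" if "b \<in> S" for b
  proof -
    have "(\<integral>\<^sup>+z. ennreal ((z b)\<^sup>2) \<partial>gauss \<sigma> S)
        = (\<integral>\<^sup>+z. ennreal (z\<^sup>2) \<partial>distr (gauss \<sigma> S) ?M (\<lambda>z. z b))"
      using that by (subst nn_integral_distr) (auto simp: gauss_def)
    also have "distr (gauss \<sigma> S) ?M (\<lambda>z. z b) = ?M"
      unfolding gauss_def using that by (rule PiM_component)
    finally show ?thesis using 1 by simp
  qed
  have "(\<integral>\<^sup>+z. ennreal (\<Sum>b\<in>S. (z b)\<^sup>2) \<partial>gauss \<sigma> S)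
      = (\<integral>\<^sup>+z. (\<Sum>b\<in>S. ennreal ((z b)\<^sup>2)) \<partial>gauss \<sigma> S)"
    by simp
  also have "\<dots> = (\<Sum>b\<in>S. \<integral>\<^sup>+z. ennreal ((z b)\<^sup>2) \<partial>gauss \<sigma> S)"
    by (rule nn_integral_sum) measurable
  also have "\<dots> = ennreal (real (card S) * \<sigma>\<^sup>2)"
    by (simp add: component ennreal_mult' ennreal_of_nat_eq_real_of_nat)
  finally show ?thesis .
qed


text \<open>The condition on \<open>v\<close> says that \<open>q\<close> has zero discriminant: for
  \<open>c > 0\<close> it is \<open>c\<close> times the squared distance of \<open>z\<close> to the
  pole \<open>v / (2 * c)\<close>, and for \<open>c = 0\<close> it is the constant
  \<open>\<rho>\<close>. In both cases \<open>\<rho>\<close> is its value at the origin, so the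
  first bound is the mean value inequality for a superharmonic function. The second bound does not
  depend on the position of the pole.\<close>

lemma nn_integral_gauss_powr_le:
  fixes \<sigma> s c \<rho> :: real and v :: "'a \<Rightarrow> real"
  assumes fin: "finite S" and \<sigma>: "\<sigma> > 0" and s: "0 < s" "s \<le> real (card S) - 2"
    and c: "0 \<le> c" and \<rho>: "0 \<le> \<rho>" and v: "(\<Sum>b\<in>S. (v b)\<^sup>2) = 4 * c * \<rho>"
  defines "q \<equiv> \<lambda>z. \<rho> + (\<Sum>b\<in>S. c * (z b)\<^sup>2 - v b * z b)"
  defines "I \<equiv> (\<integral>\<^sup>+z. (if q z = 0 then \<infinity> else ennreal (q z powr - (s / 2))) \<partial>gauss \<sigma> S)"
  shows "\<rho> > 0 \<Longrightarrow> I \<le> ennreal (\<rho> powr - (s / 2))"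
    and "c > 0 \<Longrightarrow> I \<le> ennreal (exp 1 * (2 * c * \<sigma>\<^sup>2) powr - (s / 2))"
proof -
  let ?h = "\<lambda>t :: real. indicator {0..} t * t powr (s / 2 - 1)"
  define a where "a = c * \<sigma>\<^sup>2"
  have a: "a \<ge> 0" using c by (simp add: a_def)
  have G: "Gamma (s / 2) > 0" using s by (intro Gamma_real_pos) simp
  note G = G less_imp_neq[OF G, symmetric]
  interpret prob_space "gauss \<sigma> S" using \<sigma> by (rule prob_space_gauss)
  interpret pair_sigma_finite "gauss \<sigma> S" lborel ..

  \<comment> \<open>For \<open>c > 0\<close> this is the square just described; for
    \<open>c = 0\<close> the condition on \<open>v\<close> forces \<open>v = 0\<close> on
    \<open>S\<close>.\<close>
  have q: "q z \<ge> 0" for z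
  proof (cases "c = 0")
    case True
    with v fin have "v b = 0" if "b \<in> S" for b using that by (simp add: sum_nonneg_eq_0_iff)
    with True \<rho> show ?thesis by (simp add: q_def)
  next
    case False
    have "4 * c * q z = (\<Sum>b\<in>S. (v b)\<^sup>2) + (\<Sum>b\<in>S. 4 * c * (c * (z b)\<^sup>2 - v b * z b))"
      by (simp add: q_def v distrib_left sum_distrib_left)
    also have "\<dots> = (\<Sum>b\<in>S. (v b - 2 * c * z b)\<^sup>2)"
      unfolding sum.distrib[symmetric]
      by (intro sum.cong refl) (simp add: algebra_simps power2_eq_square)
    also have "\<dots> \<ge> 0" by (intro sum_nonneg) simp
    finally show ?thesis using False c by (simp add: zero_le_mult_iff)
  qed
  \<comment> \<open>At a zero of \<open>q\<close> both sides are infinite.\<close>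
  have kernel: "ennreal (Gamma (s / 2)) * (if q z = 0 then \<infinity> else ennreal (q z powr - (s / 2)))
      = (\<integral>\<^sup>+t. ennreal (?h t * exp (- (q z * t))) \<partial>lborel)" for z
  proof (cases "q z = 0")
    case True
    then show ?thesis
      using nn_integral_Gamma_rate_0[of "s / 2"] s G by (simp add: ennreal_mult_top)
  next
    case False
    then show ?thesis
      using nn_integral_Gamma_rate[of "s / 2" "q z"] s G q[of z] by (simp add: ennreal_mult')
  qed
  \<comment> \<open>Averaging replaces the time \<open>t\<close> by
    \<open>t / (1 + 2 * a * t)\<close> in the exponential of rate \<open>\<rho>\<close> and adds a
    factor depending only on \<open>t\<close>. The clean exponent is due to the zero
    discriminant.\<close>
  have inner: "(\<integral>\<^sup>+z. ennreal (?h t * exp (- (q z * t))) \<partial>gauss \<sigma> S)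
      = ennreal (?h t * (1 + 2 * a * t) powr - (real (card S) / 2)
                  * exp (- (\<rho> * (t / (1 + 2 * a * t)))))" for t
  proof (cases "t \<ge> 0")
    case True
    let ?D = "1 + 2 * a * t"
    have D: "?D > 0" using True a by (simp add: add_pos_nonneg)
    have D': "1 + 2 * (t * c) * \<sigma>\<^sup>2 = ?D" by (simp add: a_def mult_ac)
    have "(\<integral>\<^sup>+z. ennreal (?h t * exp (- (q z * t))) \<partial>gauss \<sigma> S)
        = (\<integral>\<^sup>+z. ennreal (?h t * exp (- (\<rho> * t)))
             * ennreal (exp (\<Sum>b\<in>S. t * v b * z b - t * c * (z b)\<^sup>2)) \<partial>gauss \<sigma> S)"
    proof (intro nn_integral_cong)
      fix z
      have "- (q z * t) = - (\<rho> * t) + (\<Sum>b\<in>S. t * v b * z b - t * c * (z b)\<^sup>2)"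
        by (simp add: q_def sum_subtractf sum_distrib_left algebra_simps)
      then have "exp (- (q z * t))
          = exp (- (\<rho> * t)) * exp (\<Sum>b\<in>S. t * v b * z b - t * c * (z b)\<^sup>2)"
        by (simp only: exp_add)
      then show "ennreal (?h t * exp (- (q z * t))) = ennreal (?h t * exp (- (\<rho> * t)))
             * ennreal (exp (\<Sum>b\<in>S. t * v b * z b - t * c * (z b)\<^sup>2))"
        by (simp only: mult.assoc ennreal_mult''[symmetric] exp_ge_zero)
    qed
    also have "\<dots> = ennreal (?h t * exp (- (\<rho> * t)))
        * (\<integral>\<^sup>+z. ennreal (exp (\<Sum>b\<in>S. t * v b * z b - t * c * (z b)\<^sup>2)) \<partial>gauss \<sigma> S)"
      by (rule nn_integral_cmult) measurable
    also have "\<dots> = ennreal (?h t * exp (- (\<rho> * t))) *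
       ennreal (exp ((\<Sum>b\<in>S. (t * v b)\<^sup>2) * \<sigma>\<^sup>2 / (2 * ?D)) * ?D powr - (real (card S) / 2))"
      using True c \<sigma> fin by (subst nn_integral_gauss_quadratic) (auto simp: D')
    also have "(\<Sum>b\<in>S. (t * v b)\<^sup>2) * \<sigma>\<^sup>2 / (2 * ?D) = 2 * t\<^sup>2 * a * \<rho> / ?D"
    proof -
      have "(\<Sum>b\<in>S. (t * v b)\<^sup>2) * \<sigma>\<^sup>2 = 2 * (2 * t\<^sup>2 * a * \<rho>)"
        by (simp add: power_mult_distrib sum_distrib_left[symmetric] v a_def)
      then show ?thesis by (simp only: mult_divide_mult_cancel_left_if) simp
    qed
    also have "ennreal (?h t * exp (- (\<rho> * t))) *
        ennreal (exp (2 * t\<^sup>2 * a * \<rho> / ?D) * ?D powr - (real (card S) / 2))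
      = ennreal (?h t * ?D powr - (real (card S) / 2) * exp (- (\<rho> * t) + 2 * t\<^sup>2 * a * \<rho> / ?D))"
      unfolding exp_add by (subst ennreal_mult''[symmetric]) (simp_all add: mult_ac)
    also have "- (\<rho> * t) + 2 * t\<^sup>2 * a * \<rho> / ?D = - (\<rho> * (t / ?D))"
      using D by (simp add: field_simps power2_eq_square)
    finally show ?thesis .
  qed simp
  let ?R = "\<integral>\<^sup>+t. ennreal (?h t * exp (- (\<rho> * t))) * indicator {t. 2 * a * t \<le> 1} t \<partial>lborel"
  have "ennreal (Gamma (s / 2)) * I
      = (\<integral>\<^sup>+z. \<integral>\<^sup>+t. ennreal (?h t * exp (- (q z * t))) \<partial>lborel \<partial>gauss \<sigma> S)"
    unfolding I_def kernel[symmetric]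
    by (rule nn_integral_cmult[symmetric]) (unfold q_def, measurable)
  also have "\<dots> = (\<integral>\<^sup>+t. \<integral>\<^sup>+z. ennreal (?h t * exp (- (q z * t))) \<partial>gauss \<sigma> S \<partial>lborel)"
    by (rule Fubini'[symmetric]) (unfold q_def, measurable)
  \<comment> \<open>With \<open>\<alpha> = s / 2\<close> and \<open>\<beta> = card S / 2\<close>,
    the bound \<open>s \<le> card S - 2\<close> is the required condition on the exponents.\<close>
  also have "\<dots> \<le> ?R"
    unfolding inner using s a by (intro nn_integral_subst_rate_le) auto
  finally have R: "ennreal (Gamma (s / 2)) * I \<le> ?R" .

  show "I \<le> ennreal (\<rho> powr - (s / 2))" if "\<rho> > 0"
  proof -
    \<comment> \<open>Dropping the cutoff leaves the full Gamma integral of rate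
      \<open>\<rho>\<close>.\<close>
    have "?R \<le> (\<integral>\<^sup>+t. ennreal (?h t * exp (- (\<rho> * t))) \<partial>lborel)"
      by (intro nn_integral_mono) (auto simp: indicator_def)
    also have "\<dots> = ennreal (Gamma (s / 2)) * ennreal (\<rho> powr - (s / 2))"
      using nn_integral_Gamma_rate[of "s / 2" \<rho>] s that G by (simp add: ennreal_mult')
    finally have "ennreal (Gamma (s / 2)) * I \<le> ennreal (Gamma (s / 2)) * ennreal (\<rho> powr - (s / 2))"
      using R by (rule order_trans[rotated])
    then show ?thesis
      using G by (simp add: ennreal_mult_le_mult_iff)
  qed
  show "I \<le> ennreal (exp 1 * (2 * c * \<sigma>\<^sup>2) powr - (s / 2))" if "c > 0"
  proof -
    have "?R \<le> (\<integral>\<^sup>+t. ennreal (exp 1) * ennreal (?h t * exp (- (2 * a * t))) \<partial>lborel)"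
    proof (intro nn_integral_mono)
      fix t :: real
      \<comment> \<open>On the range of the cutoff the left side is at most 1 and the right side at
        least 1. This exchanges the rate \<open>\<rho>\<close>, which may be 0, for the positive
        rate \<open>2 * a\<close>.\<close>
      have "exp (- (\<rho> * t)) \<le> exp 1 * exp (- (2 * a * t))" if "t \<ge> 0" "2 * a * t \<le> 1"
        unfolding exp_add[symmetric] using that \<rho> by (auto intro: order_trans[of _ 0])
      then have "?h t * exp (- (\<rho> * t)) \<le> ?h t * (exp 1 * exp (- (2 * a * t)))" if "2 * a * t \<le> 1"
        using that by (cases "t \<ge> 0") (auto intro!: mult_left_mono)
      then show "ennreal (?h t * exp (- (\<rho> * t))) * indicator {t. 2 * a * t \<le> 1} t
          \<le> ennreal (exp 1) * ennreal (?h t * exp (- (2 * a * t)))"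
        by (subst ennreal_mult'[symmetric])
           (auto split: split_indicator simp: mult_ac intro!: ennreal_leI)
    qed
    also have "\<dots> = ennreal (exp 1) * ennreal (Gamma (s / 2) * (2 * a) powr - (s / 2))"
      using s that \<sigma> by (subst nn_integral_cmult) (auto simp: nn_integral_Gamma_rate a_def)
    also have "\<dots> = ennreal (Gamma (s / 2)) * ennreal (exp 1 * (2 * c * \<sigma>\<^sup>2) powr - (s / 2))"
      using G by (simp add: a_def mult_ac flip: ennreal_mult')
    finally have "ennreal (Gamma (s / 2)) * I \<le> ennreal (Gamma (s / 2)) * ennreal (exp 1 * (2 * c * \<sigma>\<^sup>2) powr - (s / 2))"
      using R by (rule order_trans[rotated])
    then show ?thesis
      using G by (simp add: ennreal_mult_le_mult_iff)
  qed
qed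


subsection \<open>Stereographic coordinates\<close>

text \<open>\<open>x\<close> together with \<open>S\<close> is an orthonormal basis of the ambient
  space, so \<open>S\<close> is an orthonormal basis of the tangent space of the sphere at
  \<open>x\<close>.\<close>

locale tangent_frame =
  fixes x :: "real ^ 'n" and S :: "(real ^ 'n) set"
  assumes x_notin: "x \<notin> S"
    and orthogonal_frame: "pairwise orthogonal (insert x S)"
    and norm_frame: "b \<in> insert x S \<Longrightarrow> norm b = 1"
    and span_frame: "span (insert x S) = UNIV"
    and finite_S [simp]: "finite S"
begin

definition tangent :: "(real ^ 'n \<Rightarrow> real) \<Rightarrow> real ^ 'n" where
  "tangent z = (\<Sum>b\<in>S. z b *\<^sub>R b)"

definition msq :: "(real ^ 'n \<Rightarrow> real) \<Rightarrow> real" where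
  "msq z = (\<Sum>b\<in>S. (z b)\<^sup>2)"

text \<open>Inverse stereographic projection from \<open>- x\<close>, in coordinates of the tangent space at \<open>x\<close>.\<close>

definition stereo :: "(real ^ 'n \<Rightarrow> real) \<Rightarrow> real ^ 'n" where
  "stereo z = ((1 - msq z) *\<^sub>R x + 2 *\<^sub>R tangent z) /\<^sub>R (1 + msq z)"

lemma norm_x [simp]: "norm x = 1"
  by (rule norm_frame) simp

lemma inner_x_x [simp]: "x \<bullet> x = 1"
  by (simp add: dot_square_norm)

lemma inner_x_S: "b \<in> S \<Longrightarrow> x \<bullet> b = 0"
  using orthogonal_frame x_notin by (auto simp: pairwise_def orthogonal_def)

lemma inner_x_tangent [simp]: "x \<bullet> tangent z = 0" "tangent z \<bullet> x = 0"
  by (auto simp: tangent_def inner_sum_right inner_sum_left inner_x_S inner_commute[of _ x])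

lemma inner_tangent_tangent [simp]: "tangent z \<bullet> tangent z = msq z"
proof -
  have "pairwise (\<lambda>i j. orthogonal (z i *\<^sub>R i) (z j *\<^sub>R j)) S"
    using orthogonal_frame by (auto simp: pairwise_def orthogonal_def)
  from norm_sum_Pythagorean[OF finite_S this] show ?thesis
    by (simp add: tangent_def msq_def norm_frame dot_square_norm)
qed

lemma msq_nonneg [simp]: "msq z \<ge> 0"
  by (simp add: msq_def sum_nonneg)

text \<open>By orthogonality this is the identity (1 - m)^2 + 4 m = (1 + m)^2.\<close>

lemma norm_stereo: "norm (stereo z) = 1"
proof -
  have pos: "1 + msq z > 0" using msq_nonneg[of z] by linarith
  let ?w = "(1 - msq z) *\<^sub>R x + 2 *\<^sub>R tangent z"
  have "(norm ?w)\<^sup>2 = (1 + msq z)\<^sup>2"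
    by (simp add: power2_norm_eq_inner inner_add_left inner_add_right)
       (simp add: power2_eq_square algebra_simps)
  then have "norm ?w = 1 + msq z"
    using pos by (metis norm_ge_zero less_imp_le power2_eq_imp_eq)
  then show ?thesis using pos by (simp add: stereo_def)
qed

lemma parseval: "p \<bullet> p = (p \<bullet> x)\<^sup>2 + (\<Sum>b\<in>S. (p \<bullet> b)\<^sup>2)"
proof -
  have "p \<bullet> p = p \<bullet> (\<Sum>b\<in>insert x S. (p \<bullet> b) *\<^sub>R b)"
    using orthonormal_basis_expand[OF orthogonal_frame norm_frame, of p]
    by (simp add: span_frame)
  also have "\<dots> = (p \<bullet> x)\<^sup>2 + (\<Sum>b\<in>S. (p \<bullet> b)\<^sup>2)"
    using x_notin by (simp add: inner_add_right inner_sum_right power2_eq_square)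
  finally show ?thesis .
qed

text \<open>Multiplied by the conformal factor \<open>1 + msq z\<close>, the squared chordal
  distance becomes a quadratic polynomial in \<open>z\<close>, because
  \<open>\<rho> = (1 - p \<bullet> x) / 2\<close>. The other two claims are the zero-discriminant
  and sign conditions of \<open>nn_integral_gauss_powr_le\<close> with \<open>c = 1 - \<rho>\<close>
  and \<open>v b = p \<bullet> b\<close>. The antipode \<open>p = - x\<close>, which
  \<open>stereo\<close> misses, is the case \<open>c = 0\<close>.\<close>

lemma norm_stereo_diff:
  fixes p :: "real ^ 'n"
  assumes p: "norm p = 1"
  defines "\<rho> \<equiv> (norm (x - p))\<^sup>2 / 4"
  shows "(norm (stereo z - p))\<^sup>2 * (1 + msq z)
      = 4 * (\<rho> + (\<Sum>b\<in>S. (1 - \<rho>) * (z b)\<^sup>2 - p \<bullet> b * z b))"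
    and "(\<Sum>b\<in>S. (p \<bullet> b)\<^sup>2) = 4 * (1 - \<rho>) * \<rho>"
    and "1 - \<rho> \<ge> 0"
proof -
  have pos: "1 + msq z > 0" using msq_nonneg[of z] by linarith
  have pp: "p \<bullet> p = 1" using p by (simp add: dot_square_norm)
  have ss: "stereo z \<bullet> stereo z = 1" by (simp add: dot_square_norm norm_stereo)
  have \<rho>: "\<rho> = (1 - p \<bullet> x) / 2"
    unfolding \<rho>_def power2_norm_eq_inner
    by (simp add: inner_diff_left inner_diff_right pp inner_commute)
  have "(norm (stereo z - p))\<^sup>2 = 2 - 2 * (stereo z \<bullet> p)"
    unfolding power2_norm_eq_inner
    by (simp add: inner_diff_left inner_diff_right pp ss inner_commute)
  also have "stereo z \<bullet> p * (1 + msq z) = (1 - msq z) * (p \<bullet> x) + 2 * (tangent z \<bullet> p)"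
    using pos by (simp add: stereo_def inner_add_left inner_commute[of x])
  then have "(2 - 2 * (stereo z \<bullet> p)) * (1 + msq z)
      = 2 * (1 + msq z) - 2 * (1 - msq z) * (p \<bullet> x) - 4 * (tangent z \<bullet> p)"
    by (simp add: algebra_simps)
  also have "\<dots> = 4 * (\<rho> + (1 - \<rho>) * msq z - tangent z \<bullet> p)"
    by (simp add: \<rho> field_simps)
  also have "\<dots> = 4 * (\<rho> + (\<Sum>b\<in>S. (1 - \<rho>) * (z b)\<^sup>2 - p \<bullet> b * z b))"
    by (simp add: msq_def tangent_def inner_sum_left sum_subtractf sum_distrib_left
                  inner_commute[of _ p] inner_sum_right
                  mult.commute)
  finally show "(norm (stereo z - p))\<^sup>2 * (1 + msq z)
      = 4 * (\<rho> + (\<Sum>b\<in>S. (1 - \<rho>) * (z b)\<^sup>2 - p \<bullet> b * z b))" .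
  show "(\<Sum>b\<in>S. (p \<bullet> b)\<^sup>2) = 4 * (1 - \<rho>) * \<rho>"
    using parseval[of p] by (simp add: \<rho> pp power2_eq_square field_simps)
  have "- (p \<bullet> x) \<le> 1" using Cauchy_Schwarz_ineq2[of p x] p by simp
  then show "1 - \<rho> \<ge> 0" by (simp add: \<rho>)
qed

text \<open>The weight cancels the conformal factor and leaves an inverse power of the quadratic
  polynomial \<open>q\<close>. The poles agree as well, since \<open>q z = 0\<close> exactly when
  \<open>stereo z = p\<close>.\<close>

lemma riesz_kernel_stereo:
  fixes p :: "real ^ 'n"
  assumes p: "norm p = 1" and s: "s > 0"
  defines "\<rho> \<equiv> (norm (x - p))\<^sup>2 / 4"
  defines "q \<equiv> \<lambda>z. \<rho> + (\<Sum>b\<in>S. (1 - \<rho>) * (z b)\<^sup>2 - p \<bullet> b * z b)"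
  shows "ennreal ((1 + msq z) powr - (s / 2)) * riesz_kernel s (stereo z) p
     = ennreal (2 powr - s / s) * (if q z = 0 then \<infinity> else ennreal (q z powr - (s / 2)))"
proof -
  have pos: "1 + msq z > 0" using msq_nonneg[of z] by linarith
  have q: "q z = (norm (stereo z - p))\<^sup>2 * (1 + msq z) / 4"
    using norm_stereo_diff(1)[OF p, of z] by (simp add: q_def \<rho>_def)
  show ?thesis
  proof (cases "stereo z = p")
    case True
    then show ?thesis using q s pos by (simp add: riesz_kernel_def ennreal_mult_top)
  next
    case False
    then have n: "norm (stereo z - p) > 0" by simp
    have "q z powr - (s / 2) = norm (stereo z - p) powr - s * (1 + msq z) powr - (s / 2) * 2 powr s"
    proof -
      have "((norm (stereo z - p))\<^sup>2) powr - (s / 2) = norm (stereo z - p) powr - s"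
        using n by (simp add: powr_powr flip: powr_numeral)
      moreover have "(1 / 4 :: real) = 2 powr - 2"
        by (simp add: powr_minus_divide)
      then have "(1 / 4 :: real) powr - (s / 2) = 2 powr s"
        by (simp only: powr_powr) simp
      moreover have "q z powr - (s / 2) = ((norm (stereo z - p))\<^sup>2) powr - (s / 2)
          * (1 + msq z) powr - (s / 2) * (1 / 4) powr - (s / 2)"
        using pos n by (simp add: q powr_mult[symmetric])
      ultimately show ?thesis by simp
    qed
    moreover have "q z > 0" unfolding q using n pos by simp
    then have "q z \<noteq> 0" by simp
    ultimately show ?thesis
      using False s by (simp add: riesz_kernel_def powr_minus_divide flip: ennreal_mult')
  qed
qed

section \<open>Weighted Gaussian averages of the kernel\<close>

definition avg_kernel :: "real \<Rightarrow> real \<Rightarrow> real ^ 'n \<Rightarrow> ennreal" where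
  "avg_kernel s \<sigma> p =
     (\<integral>\<^sup>+z. ennreal ((1 + msq z) powr - (s / 2)) * riesz_kernel s (stereo z) p \<partial>gauss \<sigma> S)"

lemma measurable_msq [measurable]: "msq \<in> borel_measurable (gauss \<sigma> S)"
  unfolding msq_def by measurable

lemma measurable_weighted_kernel:
  assumes "norm p = 1" "s > 0"
  shows "(\<lambda>z. ennreal ((1 + msq z) powr - (s / 2)) * riesz_kernel s (stereo z) p)
      \<in> borel_measurable (gauss \<sigma> S)"
  unfolding riesz_kernel_stereo[OF assms] by measurable

text \<open>The origin of the coordinates is \<open>x\<close>, where \<open>q\<close> takes the
  value \<open>\<rho>\<close>; the mean value inequality therefore gives back the kernel at
  \<open>x\<close>. The second bound needs \<open>c = 1 - \<rho>\<close> away from 0, and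
  \<open>p\<close> in the closed hemisphere around \<open>x\<close> gives
  \<open>c \<ge> 1/2\<close>.\<close>

lemma
  assumes p: "norm p = 1" and s: "0 < s" "s \<le> real (card S) - 2" and \<sigma>: "\<sigma> > 0"
  shows avg_kernel_le: "avg_kernel s \<sigma> p \<le> riesz_kernel s x p"
    and avg_kernel_le_near: "(norm (x - p))\<^sup>2 \<le> 2 \<Longrightarrow>
           avg_kernel s \<sigma> p \<le> ennreal (2 powr - s / s * exp 1 * \<sigma> powr - s)"
proof -
  define \<rho> where "\<rho> = (norm (x - p))\<^sup>2 / 4"
  define I where "I = (\<integral>\<^sup>+z. (if \<rho> + (\<Sum>b\<in>S. (1 - \<rho>) * (z b)\<^sup>2 - p \<bullet> b * z b) = 0 then \<infinity>
      else ennreal ((\<rho> + (\<Sum>b\<in>S. (1 - \<rho>) * (z b)\<^sup>2 - p \<bullet> b * z b)) powr - (s / 2))) \<partial>gauss \<sigma> S)"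
  have avg: "avg_kernel s \<sigma> p = ennreal (2 powr - s / s) * I"
    unfolding avg_kernel_def I_def \<rho>_def riesz_kernel_stereo[OF p s(1)]
    by (rule nn_integral_cmult) measurable
  have "1 - \<rho> \<ge> 0" "\<rho> \<ge> 0" "(\<Sum>b\<in>S. (p \<bullet> b)\<^sup>2) = 4 * (1 - \<rho>) * \<rho>"
    using norm_stereo_diff(2,3)[OF p] by (simp_all add: \<rho>_def)
  note I = nn_integral_gauss_powr_le[OF finite_S \<sigma> s this, folded I_def]
  show "avg_kernel s \<sigma> p \<le> riesz_kernel s x p"
  proof (cases "x = p")
    case False
    then have n: "norm (x - p) > 0" by simp
    have "avg_kernel s \<sigma> p \<le> ennreal (2 powr - s / s) * ennreal (\<rho> powr - (s / 2))"
      unfolding avg using I(1) n by (intro mult_left_mono) (auto simp: \<rho>_def)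
    also have "\<rho> powr - (s / 2) = norm (x - p) powr - s * 2 powr s"
    proof -
      have "\<rho> = (norm (x - p) / 2)\<^sup>2" by (simp add: \<rho>_def power_divide)
      also have "\<dots> powr - (s / 2) = (norm (x - p) / 2) powr - s"
        using n by (simp add: powr_powr flip: powr_numeral)
      finally show ?thesis by (simp add: powr_divide powr_minus_divide)
    qed
    finally show ?thesis
      using False s by (simp add: riesz_kernel_def powr_minus_divide flip: ennreal_mult')
  qed (simp add: riesz_kernel_def)
  show "avg_kernel s \<sigma> p \<le> ennreal (2 powr - s / s * exp 1 * \<sigma> powr - s)"
    if "(norm (x - p))\<^sup>2 \<le> 2"
  proof -
    have \<rho>: "2 * (1 - \<rho>) \<ge> 1" using that by (simp add: \<rho>_def)
    have "(2 * (1 - \<rho>) * \<sigma>\<^sup>2) powr - (s / 2) \<le> (\<sigma>\<^sup>2) powr - (s / 2)"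
      using mult_right_mono[OF \<rho>, of "\<sigma>\<^sup>2"] \<sigma> s by (intro powr_mono2') auto
    also have "(\<sigma>\<^sup>2) powr - (s / 2) = \<sigma> powr - s"
      using \<sigma> by (simp add: powr_powr flip: powr_numeral)
    finally have "ennreal (exp 1 * (2 * (1 - \<rho>) * \<sigma>\<^sup>2) powr - (s / 2)) \<le> ennreal (exp 1 * \<sigma> powr - s)"
      by (intro ennreal_leI mult_left_mono) auto
    with I(2) \<rho> have "I \<le> ennreal (exp 1 * \<sigma> powr - s)" by (auto intro: order_trans)
    then have "avg_kernel s \<sigma> p \<le> ennreal (2 powr - s / s) * ennreal (exp 1 * \<sigma> powr - s)"
      unfolding avg by (rule mult_left_mono) simp
    then show ?thesis using s by (simp add: mult.assoc flip: ennreal_mult')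
  qed
qed

text \<open>In the hemisphere around \<open>x\<close> the near bound applies; outside it the
  distance to \<open>x\<close> exceeds 1, so the kernel at \<open>x\<close> is at most
  \<open>1 / s\<close>.\<close>

lemma avg_kernel_le_uniform:
  assumes "norm p = 1" "0 < s" "s \<le> real (card S) - 2" "\<sigma> > 0"
  shows "avg_kernel s \<sigma> p \<le> ennreal (2 powr - s / s * exp 1 * \<sigma> powr - s + 1 / s)"
proof (cases "(norm (x - p))\<^sup>2 \<le> 2")
  case True
  from avg_kernel_le_near[OF assms True] show ?thesis
    using assms by (elim order_trans) (intro ennreal_leI, simp)
next
  case False
  then have n: "norm (x - p) \<ge> 1"
    by (smt (verit) norm_ge_zero power_le_one)
  then have "norm (x - p) powr - s \<le> 1 powr - s"
    using assms by (intro powr_mono2') auto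
  then have "riesz_kernel s x p \<le> ennreal (1 / s)"
    using n assms by (auto simp: riesz_kernel_def divide_le_cancel intro!: ennreal_leI)
  also have "\<dots> \<le> ennreal (2 powr - s / s * exp 1 * \<sigma> powr - s + 1 / s)"
    using assms by (intro ennreal_leI) simp
  finally show ?thesis using avg_kernel_le[OF assms] by (rule order_trans[rotated])
qed

text \<open>Bernoulli's inequality bounds the weight below by \<open>1 - s / 2 * msq z\<close>, and
  \<open>msq\<close> has mean \<open>card S * \<sigma>\<^sup>2\<close>. The inequality is first used
  in additive form, so that all integrands are nonnegative.\<close>

lemma nn_integral_weight_ge:
  assumes "s > 0" "\<sigma> > 0"
  shows "ennreal (1 - s / 2 * (real (card S) * \<sigma>\<^sup>2))
      \<le> (\<integral>\<^sup>+z. ennreal ((1 + msq z) powr - (s / 2)) \<partial>gauss \<sigma> S)" (is "_ \<le> ?W")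
proof -
  interpret prob_space "gauss \<sigma> S" using assms(2) by (rule prob_space_gauss)
  have bern: "1 \<le> (1 + m) powr - (s / 2) + s / 2 * m" if "m \<ge> 0" for m :: real
  proof -
    have "- (s / 2) * m \<le> - (s / 2) * ln (1 + m)"
      using assms that ln_add_one_self_le_self[of m] by (intro mult_left_mono_neg) auto
    then have "1 + - (s / 2) * m \<le> 1 + - (s / 2) * ln (1 + m)" by simp
    also have "\<dots> \<le> exp (- (s / 2) * ln (1 + m))" by (rule exp_ge_add_one_self)
    also have "\<dots> = (1 + m) powr - (s / 2)" using that by (simp add: powr_def)
    finally show ?thesis by simp
  qed
  have "1 = (\<integral>\<^sup>+z. 1 \<partial>gauss \<sigma> S)" by (simp add: emeasure_space_1)
  also have "\<dots> \<le> (\<integral>\<^sup>+z. ennreal ((1 + msq z) powr - (s / 2)) + ennreal (s / 2) * ennreal (msq z) \<partial>gauss \<sigma> S)"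
  proof (intro nn_integral_mono)
    fix z
    have "ennreal 1 \<le> ennreal ((1 + msq z) powr - (s / 2) + s / 2 * msq z)"
      by (intro ennreal_leI bern) simp
    then show "1 \<le> ennreal ((1 + msq z) powr - (s / 2)) + ennreal (s / 2) * ennreal (msq z)"
      using assms by (simp add: ennreal_plus flip: ennreal_mult')
  qed
  also have "\<dots> = ?W + ennreal (s / 2) * (\<integral>\<^sup>+z. ennreal (msq z) \<partial>gauss \<sigma> S)"
    by (simp add: nn_integral_add nn_integral_cmult)
  also have "(\<integral>\<^sup>+z. ennreal (msq z) \<partial>gauss \<sigma> S) = ennreal (real (card S) * \<sigma>\<^sup>2)"
    unfolding msq_def by (rule nn_integral_gauss_square) (use assms in auto)
  also have "ennreal (s / 2) * \<dots> = ennreal (s / 2 * (real (card S) * \<sigma>\<^sup>2))"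
    using assms by (intro ennreal_mult'[symmetric]) simp
  finally have "ennreal 1 \<le> ?W + ennreal (s / 2 * (real (card S) * \<sigma>\<^sup>2))" by simp
  then have "ennreal 1 - ennreal (s / 2 * (real (card S) * \<sigma>\<^sup>2)) \<le> ?W"
    by (simp add: ennreal_minus_le_iff add.commute)
  then show ?thesis using assms by (subst (asm) ennreal_minus) auto
qed

section \<open>Bounds at a minimum of the potential\<close>

lemma minimizer_potential_le:
  assumes p: "\<And>j. j \<in> {1..N} \<Longrightarrow> norm (p j) = 1"
    and min: "\<And>y. norm y = 1 \<Longrightarrow> riesz_potential s N p x \<le> riesz_potential s N p y"
    and s: "s > 0" and \<sigma>: "\<sigma> > 0"
  shows "ennreal (1 - s / 2 * (real (card S) * \<sigma>\<^sup>2)) * riesz_potential s N p x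
           \<le> (\<Sum>j=1..N. avg_kernel s \<sigma> (p j))"
proof -
  let ?w = "\<lambda>z. ennreal ((1 + msq z) powr - (s / 2))"
  have "ennreal (1 - s / 2 * (real (card S) * \<sigma>\<^sup>2)) * riesz_potential s N p x
      \<le> (\<integral>\<^sup>+z. ?w z \<partial>gauss \<sigma> S) * riesz_potential s N p x"
    using s \<sigma> by (intro mult_right_mono nn_integral_weight_ge) auto
  also have "\<dots> = (\<integral>\<^sup>+z. ?w z * riesz_potential s N p x \<partial>gauss \<sigma> S)"
    by (rule nn_integral_multc[symmetric]) measurable
  \<comment> \<open>Minimality of \<open>x\<close> is applied at every point \<open>stereo z\<close>
    of the sphere before integrating.\<close>
  also have "\<dots> \<le> (\<integral>\<^sup>+z. ?w z * riesz_potential s N p (stereo z) \<partial>gauss \<sigma> S)"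
    by (intro nn_integral_mono mult_left_mono min norm_stereo) simp
  also have "\<dots> = (\<integral>\<^sup>+z. (\<Sum>j=1..N. ?w z * riesz_kernel s (stereo z) (p j)) \<partial>gauss \<sigma> S)"
    by (simp add: riesz_potential_def sum_distrib_left)
  also have "\<dots> = (\<Sum>j=1..N. avg_kernel s \<sigma> (p j))"
    unfolding avg_kernel_def using p s
    by (intro nn_integral_sum measurable_weighted_kernel) auto
  finally show ?thesis .
qed

lemma minimizer_potential_bounded:
  assumes p: "\<And>j. j \<in> {1..N} \<Longrightarrow> norm (p j) = 1"
    and min: "\<And>y. norm y = 1 \<Longrightarrow> riesz_potential s N p x \<le> riesz_potential s N p y"
    and s: "0 < s" "s \<le> real (card S) - 2"
  defines "M \<equiv> 2 * (2 powr - s / s * exp 1 * sqrt (1 / (s * real (card S))) powr - s + 1 / s)"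
  shows "riesz_potential s N p x \<le> ennreal (M * real N)"
proof -
  \<comment> \<open>The variance for which the lower bound of the total weight is exactly 1/2. No
    finiteness of the potential is presupposed; it is a consequence.\<close>
  define \<sigma> where "\<sigma> = sqrt (1 / (s * real (card S)))"
  have "s * real (card S) > 0" using s by (intro mult_pos_pos) auto
  then have \<sigma>: "\<sigma> > 0" "\<sigma>\<^sup>2 = 1 / (s * real (card S))" by (auto simp: \<sigma>_def)
  have half: "1 - s / 2 * (real (card S) * \<sigma>\<^sup>2) = 1 / 2" using s by (auto simp: \<sigma>)
  have "ennreal (1 / 2) * riesz_potential s N p x \<le> (\<Sum>j=1..N. avg_kernel s \<sigma> (p j))"
    using minimizer_potential_le[OF p min s(1) \<sigma>(1)] unfolding half .
  also have "\<dots> \<le> (\<Sum>j=1..N. ennreal (M / 2))"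
  proof (intro sum_mono)
    fix j assume "j \<in> {1..N}"
    from avg_kernel_le_uniform[OF p[OF this] s \<sigma>(1)] show "avg_kernel s \<sigma> (p j) \<le> ennreal (M / 2)"
      by (simp add: M_def \<sigma>_def add_divide_distrib)
  qed
  also have "\<dots> = ennreal (1 / 2) * ennreal (M * real N)"
  proof -
    have "M \<ge> 0" using s by (simp add: M_def)
    then have "(\<Sum>j=1..N. ennreal (M / 2)) = ennreal (1 / 2 * (M * real N))"
      by (subst sum_ennreal) (simp_all add: mult.commute)
    then show ?thesis by (simp only: ennreal_mult')
  qed
  finally show ?thesis by (subst (asm) ennreal_mult_le_mult_iff) auto
qed

text \<open>Replacing the \<open>j\<close>-th kernel by its average costs at most a multiple of
  \<open>\<sigma> powr - s\<close>, while the deficit of the weight costs a multiple of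
  \<open>\<sigma>\<^sup>2 * N\<close>, as the potential at \<open>x\<close> is at most
  \<open>M * N\<close>. Comparing with minimality bounds the \<open>j\<close>-th kernel by the two
  errors.\<close>

lemma minimizer_separation:
  assumes p: "\<And>j. j \<in> {1..N} \<Longrightarrow> norm (p j) = 1"
    and min: "\<And>y. norm y = 1 \<Longrightarrow> riesz_potential s N p x \<le> riesz_potential s N p y"
    and s: "0 < s" "s \<le> real (card S) - 2"
    and j: "j \<in> {1..N}"
  defines "M \<equiv> 2 * (2 powr - s / s * exp 1 * sqrt (1 / (s * real (card S))) powr - s + 1 / s)"
  defines "A \<equiv> 2 powr - s * exp 1 + s\<^sup>2 / 2 * real (card S) * M"
  shows "norm (x - p j) \<ge> min 1 (A powr - (1 / s)) * real N powr (- 1 / (s + 2))"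
proof (cases "norm (x - p j) \<ge> 1")
  case True
  \<comment> \<open>The minimum with 1 in the constant covers this case, as
    \<open>N \<ge> 1\<close>.\<close>
  have "real N powr (- 1 / (s + 2)) \<le> 1"
    using j s powr_mono2'[of "- 1 / (s + 2)" 1 "real N"] by (simp add: divide_nonpos_pos)
  then have "min 1 (A powr - (1 / s)) * real N powr (- 1 / (s + 2)) \<le> 1 * 1"
    by (intro mult_mono) auto
  with True show ?thesis by simp
next
  case False
  \<comment> \<open>This choice balances the errors:
    \<open>\<sigma>\<^sup>2 * real N = \<sigma> powr - s\<close>.\<close>
  define \<sigma> where "\<sigma> = real N powr (- 1 / (s + 2))"
  have N: "real N > 0" using j by auto
  have \<sigma>: "\<sigma> > 0" using N by (simp add: \<sigma>_def)
  have M: "M > 0" using s by (simp add: M_def add_nonneg_pos)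
  have A: "A > 0" using M s by (simp add: A_def add_pos_nonneg)
  have pot: "riesz_potential s N p x \<le> ennreal (M * real N)"
    unfolding M_def using p min s by (rule minimizer_potential_bounded)
  \<comment> \<open>The bound on the potential makes every kernel value finite, so \<open>x\<close>
    is none of the points, and the estimate can be done in real numbers, where \<open>U\<close> may
    be subtracted.\<close>
  define k where "k i = enn2real (riesz_kernel s x (p i))" for i
  have "riesz_kernel s x (p i) \<le> riesz_potential s N p x" if "i \<in> {1..N}" for i
    unfolding riesz_potential_def using that by (intro member_le_sum) auto
  then have k: "riesz_kernel s x (p i) = ennreal (k i)" if "i \<in> {1..N}" for i
    using that pot unfolding k_def
    by (metis ennreal_enn2real ennreal_less_top order_le_less_trans)
  have k_nonneg: "k i \<ge> 0" for i by (simp add: k_def)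
  define U where "U = (\<Sum>i=1..N. k i)"
  have U: "riesz_potential s N p x = ennreal U"
    unfolding riesz_potential_def U_def by (simp add: k k_nonneg)
  have U_le: "U \<le> M * real N" using pot M unfolding U by (simp add: ennreal_le_iff)
  have U_nonneg: "U \<ge> 0" unfolding U_def by (intro sum_nonneg k_nonneg)
  define F where "F = 2 powr - s / s * exp 1 * \<sigma> powr - s"
  have F: "F \<ge> 0" using s by (simp add: F_def)
  have U_j: "U = k j + (\<Sum>i\<in>{1..N} - {j}. k i)"
    unfolding U_def using j by (subst sum.remove[of _ j]) auto
  have "(norm (x - p j))\<^sup>2 \<le> 1" using False by (intro power_le_one) auto
  then have near: "avg_kernel s \<sigma> (p j) \<le> ennreal F"
    unfolding F_def using p[OF j] s \<sigma> by (intro avg_kernel_le_near) auto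
  have "ennreal (1 - s / 2 * (real (card S) * \<sigma>\<^sup>2)) * ennreal U \<le> (\<Sum>i=1..N. avg_kernel s \<sigma> (p i))"
    using minimizer_potential_le[OF p min s(1) \<sigma>] unfolding U .
  also have "\<dots> = avg_kernel s \<sigma> (p j) + (\<Sum>i\<in>{1..N} - {j}. avg_kernel s \<sigma> (p i))"
    using j by (subst sum.remove[of _ j]) auto
  \<comment> \<open>Only the \<open>j\<close>-th average gets the near bound. The others are bounded
    by their values at \<open>x\<close>, so that \<open>U\<close> without its \<open>j\<close>-th
    term reappears.\<close>
  also have "\<dots> \<le> ennreal F + (\<Sum>i\<in>{1..N} - {j}. ennreal (k i))"
    using near p s \<sigma> by (intro add_mono sum_mono) (auto simp flip: k intro!: avg_kernel_le)
  also have "\<dots> = ennreal (F + U - k j)"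
    using F k_nonneg by (simp add: U_j sum_nonneg flip: ennreal_plus)
  finally have le: "ennreal ((1 - s / 2 * (real (card S) * \<sigma>\<^sup>2)) * U) \<le> ennreal (F + U - k j)"
    using U_nonneg by (simp add: ennreal_mult'')
  have "F + U - k j \<ge> 0" using F k_nonneg by (simp add: U_j sum_nonneg)
  with le have "(1 - s / 2 * (real (card S) * \<sigma>\<^sup>2)) * U \<le> F + U - k j"
    by (simp add: ennreal_le_iff)
  then have "k j \<le> F + s / 2 * (real (card S) * \<sigma>\<^sup>2) * U"
    by (simp add: algebra_simps)
  also have "\<dots> \<le> F + s / 2 * (real (card S) * \<sigma>\<^sup>2) * (M * real N)"
    using U_le s by (intro add_left_mono mult_left_mono) auto
  also have "\<dots> = F + s / 2 * real (card S) * M * (\<sigma>\<^sup>2 * real N)"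
    by (simp add: mult_ac)
  also have "\<sigma>\<^sup>2 * real N = \<sigma> powr - s"
  proof -
    have "\<sigma>\<^sup>2 * real N = real N powr (2 * (- 1 / (s + 2))) * real N powr 1"
      using N by (simp add: \<sigma>_def powr_powr mult.commute flip: powr_numeral)
    also have "\<dots> = real N powr (2 * (- 1 / (s + 2)) + 1)" by (simp only: powr_add)
    also have "2 * (- 1 / (s + 2)) + 1 = (- 1 / (s + 2)) * - s"
      using s by (simp add: field_simps)
    finally show ?thesis by (simp only: \<sigma>_def powr_powr)
  qed
  finally have "s * k j \<le> s * (F + s / 2 * real (card S) * M * \<sigma> powr - s)"
    using s by (intro mult_left_mono) auto
  also have "\<dots> = A * \<sigma> powr - s"
    using s by (simp add: F_def A_def algebra_simps power2_eq_square)
  finally have kj: "s * k j \<le> A * \<sigma> powr - s" .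
  have neq: "x \<noteq> p j" using k[OF j] by (auto simp: riesz_kernel_def)
  then have "k j = 1 / s * norm (x - p j) powr - s" using s by (simp add: k_def riesz_kernel_def)
  with kj s have le: "norm (x - p j) powr - s \<le> A * \<sigma> powr - s" by simp
  \<comment> \<open>Taking the power \<open>- 1 / s\<close> reverses the inequality and turns the
    kernel bound into a distance bound.\<close>
  have "A powr - (1 / s) * \<sigma> = (A * \<sigma> powr - s) powr - (1 / s)"
    using A \<sigma> s by (simp add: powr_mult powr_powr)
  also have "\<dots> \<le> (norm (x - p j) powr - s) powr - (1 / s)"
    using le neq s by (intro powr_mono2') auto
  also have "\<dots> = norm (x - p j)" using neq s by (simp add: powr_powr)
  finally have "A powr - (1 / s) * \<sigma> \<le> norm (x - p j)" .
  moreover have "min 1 (A powr - (1 / s)) * \<sigma> \<le> A powr - (1 / s) * \<sigma>"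
    using \<sigma> by (intro mult_right_mono) auto
  ultimately show ?thesis unfolding \<sigma>_def by linarith
qed

end

section \<open>Frames at arbitrary points and the uniform constant\<close>

lemma tangent_frame_exists:
  fixes x :: "real ^ 'n"
  assumes "norm x = 1"
  obtains S where "tangent_frame x S" "card S = CARD('n) - 1"
proof -
  obtain B where B: "x \<in> B" "pairwise orthogonal B" "\<And>b. b \<in> B \<Longrightarrow> norm b = 1"
    "independent B" "card B = DIM(real ^ 'n)" "span B = UNIV"
    using vector_in_orthonormal_basis[OF assms] by metis
  have fin: "finite B" using B(4) by (rule independent_imp_finite)
  have ins: "insert x (B - {x}) = B" using B(1) by auto
  show thesis
  proof (rule that)
    show "tangent_frame x (B - {x})"
      by unfold_locales (use B fin ins in auto)
    show "card (B - {x}) = CARD('n) - 1" using B(1,5) fin by simp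
  qed
qed

theorem theorem5p4:
  fixes d :: nat and s C :: real
  assumes "CARD('n::finite) = d + 1"
    and "d \<ge> 3"
    and "s \<in> {0<..real d - 2}"
    and "C > 0"
  shows "\<exists>B>0. \<forall>(N::nat) (p :: nat \<Rightarrow> real ^ 'n) (x :: real ^ 'n).
           (\<forall>j\<in>{1..N}. p j \<in> sphere 0 1) \<longrightarrow>
           enn2ereal (polarization s N p) \<ge>
             ereal (real N) * enn2ereal (riesz_energy TYPE('n) s)
             - ereal (C * s * real N powr (s / (s + 2))) \<longrightarrow>
           x \<in> sphere 0 1 \<longrightarrow>
           riesz_potential s N p x = polarization s N p \<longrightarrow>
           (\<forall>j\<in>{1..N}. norm (x - p j) \<ge> B * real N powr (- 1 / (s + 2)))"
proof -
  have s: "0 < s" "s \<le> real d - 2" using assms(3) by auto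
  \<comment> \<open>The constants of \<open>minimizer_separation\<close> with \<open>card S\<close>
    replaced by \<open>d\<close>; they depend on \<open>s\<close> and \<open>d\<close> alone, so
    they can be fixed before \<open>N\<close> and the configuration.\<close>
  define M where "M = 2 * (2 powr - s / s * exp 1 * sqrt (1 / (s * real d)) powr - s + 1 / s)"
  define A where "A = 2 powr - s * exp 1 + s\<^sup>2 / 2 * real d * M"
  have "M > 0" using s by (simp add: M_def add_nonneg_pos)
  then have "A > 0" using s by (simp add: A_def add_pos_nonneg)
  show ?thesis
  proof (intro exI[of _ "min 1 (A powr - (1 / s))"] conjI allI impI ballI)
    show "min 1 (A powr - (1 / s)) > 0" using \<open>A > 0\<close> by simp
    fix N j and p :: "nat \<Rightarrow> real ^ 'n" and x :: "real ^ 'n"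
    assume p: "\<forall>j\<in>{1..N}. p j \<in> sphere 0 1" and x: "x \<in> sphere 0 1"
      and min: "riesz_potential s N p x = polarization s N p" and j: "j \<in> {1..N}"
    obtain S where "tangent_frame x S" and "card S = CARD('n) - 1"
      using x tangent_frame_exists[of x] by auto
    then have card: "card S = d" using assms(1) by simp
    interpret tangent_frame x S by fact
    \<comment> \<open>The potential at \<open>x\<close> equals the infimum over the sphere, so
      \<open>x\<close> is a minimizer.\<close>
    have "riesz_potential s N p x \<le> riesz_potential s N p y" if "norm y = 1" for y
      unfolding min polarization_def using that by (intro INF_lower) simp
    then show "norm (x - p j) \<ge> min 1 (A powr - (1 / s)) * real N powr (- 1 / (s + 2))"
      using minimizer_separation[of N p s j] p s j
      by (simp add: card M_def A_def)
  qed
qed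


end
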